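(* Let $M\subset\mathbb{M}_2$ be a unital subspace. Then $M$ has the pure extension property in $C^*(M)$.
   Context: $\mathbb{M}_2$ is the $C^*$-algebra of complex $2\times2$ matrices. A unital subspace is a complex linear subspace (not necessarily self-adjoint) containing the identity $I$; $C^*(M)$ is the $C^*$-subalgebra generated by $M$. A state on a unital subspace $M$ of a $C^*$-algebra is a contractive linear functional $\phi:M\to\mathbb{C}$ with $\phi(I)=1$; it is pure if it is an extreme point of the convex set of all states on $M$. A unital subspace $M$ of a unital $C^*$-algebra $B$ has the pure extension property in $B$ if every pure state on $M$ admits a unique extension to a state on $B$. *)

theory Defs
  imports "HOL-Analysis.Analysis"
begin

text \<open>
  The C*-algebra of complex $n \times n$ matrices is the type \<open>complex^'n^'n\<close>, with product
  \<open>A ** B\<close> and identity \<open>mat 1\<close>.  The library norm on this type is the Frobenius norm, so the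
  C*-norm is introduced separately, as the operator norm with respect to the Euclidean norm
  on \<open>complex^'n\<close>.
\<close>

definition matrix_opnorm :: "complex^'n^'n \<Rightarrow> real" where
  "matrix_opnorm A = onorm (\<lambda>v. A *v v)"

definition matrix_star :: "complex^'n^'n \<Rightarrow> complex^'n^'n" where
  "matrix_star A = map_matrix cnj (transpose A)"

text \<open>
  The library provides only real scalar multiplication of matrices; this is the
  complex one.
\<close>

definition matrix_scale :: "complex \<Rightarrow> complex^'n^'n \<Rightarrow> complex^'n^'n" where
  "matrix_scale c A = map_matrix (\<lambda>x. c * x) A"

interpretation matrix_space: vector_space "matrix_scale :: complex \<Rightarrow> complex^'n^'n \<Rightarrow> complex^'n^'n"
  by unfold_locales (simp_all add: matrix_scale_def vec_eq_iff algebra_simps)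

definition unital_subspace :: "(complex^'n^'n) set \<Rightarrow> bool" where
  "unital_subspace M \<longleftrightarrow> matrix_space.subspace M \<and> mat 1 \<in> M"

text \<open>
  \<open>closed\<close> refers to the library topology of \<open>complex^'n^'n\<close>, which is the topology of the
  operator norm: see \<open>tendsto_matrix_opnorm_iff\<close> below.
\<close>

definition cstar_subalgebra :: "(complex^'n^'n) set \<Rightarrow> bool" where
  "cstar_subalgebra B \<longleftrightarrow>
     matrix_space.subspace B \<and>
     (\<forall>x\<in>B. \<forall>y\<in>B. x ** y \<in> B) \<and>
     (\<forall>x\<in>B. matrix_star x \<in> B) \<and>
     closed B"

definition cstar_generated :: "(complex^'n^'n) set \<Rightarrow> (complex^'n^'n) set" where
  "cstar_generated M = cstar_subalgebra hull M"

text \<open>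
  A functional on \<open>M\<close> is represented by a function that is \<open>undefined\<close> outside \<open>M\<close>, so that
  equality of states is equality of their values on \<open>M\<close>.
\<close>

definition states :: "(complex^'n^'n) set \<Rightarrow> (complex^'n^'n \<Rightarrow> complex) set" where
  "states M = {\<phi> \<in> extensional M.
     (\<forall>x\<in>M. \<forall>y\<in>M. \<phi> (x + y) = \<phi> x + \<phi> y) \<and>
     (\<forall>c. \<forall>x\<in>M. \<phi> (matrix_scale c x) = c * \<phi> x) \<and>
     (\<forall>x\<in>M. cmod (\<phi> x) \<le> matrix_opnorm x) \<and>
     \<phi> (mat 1) = 1}"

text \<open>
  The library's \<open>extreme_point_of\<close> needs a type of class \<open>real_vector\<close>, which a function type
  is not; its definition is written out here.
\<close>

definition pure_state :: "(complex^'n^'n) set \<Rightarrow> (complex^'n^'n \<Rightarrow> complex) \<Rightarrow> bool" where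
  "pure_state M \<phi> \<longleftrightarrow>
     \<phi> \<in> states M \<and>
     \<not> (\<exists>\<psi>\<^sub>1\<in>states M. \<exists>\<psi>\<^sub>2\<in>states M. \<exists>t::real. \<psi>\<^sub>1 \<noteq> \<psi>\<^sub>2 \<and> 0 < t \<and> t < 1 \<and>
          (\<forall>x\<in>M. \<phi> x = of_real (1 - t) * \<psi>\<^sub>1 x + of_real t * \<psi>\<^sub>2 x))"

definition pure_extension_property :: "(complex^'n^'n) set \<Rightarrow> (complex^'n^'n) set \<Rightarrow> bool" where
  "pure_extension_property M B \<longleftrightarrow>
     (\<forall>\<phi>. pure_state M \<phi> \<longrightarrow> (\<exists>!\<psi>. \<psi> \<in> states B \<and> (\<forall>x\<in>M. \<psi> x = \<phi> x)))"

lemma subset_cstar_generated: "M \<subseteq> cstar_generated M"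
  unfolding cstar_generated_def by (rule hull_subset)

lemma cstar_subalgebra_cstar_generated: "cstar_subalgebra (cstar_generated M)"
  unfolding cstar_generated_def
proof (rule hull_in)
  fix T :: "(complex^'n^'n) set set"
  assume "Ball T cstar_subalgebra"
  then show "cstar_subalgebra (\<Inter>T)"
    unfolding cstar_subalgebra_def
    by (auto intro!: matrix_space.subspace_Inter closed_Inter)
qed

lemma bounded_linear_matrix_vector_complex:
  "bounded_linear (\<lambda>v. (A::complex^'n^'m) *v v)"
  by (intro linear_conv_bounded_linear[THEN iffD1] linearI)
     (simp_all add: matrix_vector_mult_def vec_eq_iff algebra_simps sum.distrib scaleR_sum_right)

lemma matrix_opnorm_component: "cmod (A $ i $ j) \<le> matrix_opnorm A"
proof -
  have "A $ i $ j = (A *v axis j 1) $ i"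
    by (simp add: matrix_vector_mult_def axis_def if_distrib cong: if_cong)
  then have "cmod (A $ i $ j) \<le> norm (A *v axis j 1)"
    by (simp add: component_le_norm_cart Finite_Cartesian_Product.norm_nth_le)
  also have "\<dots> \<le> matrix_opnorm A * norm (axis j (1::complex))"
    unfolding matrix_opnorm_def by (rule onorm[OF bounded_linear_matrix_vector_complex])
  finally show ?thesis
    by (simp add: norm_axis_1)
qed

lemma norm_vec_le_sum: "norm (v :: ('a::real_normed_vector)^'n) \<le> (\<Sum>i\<in>UNIV. norm (v $ i))"
  by (simp add: norm_vec_def L2_set_le_sum)

lemma matrix_opnorm_le_norm:
  "matrix_opnorm (A::complex^'n^'n) \<le> of_nat (CARD('n) * CARD('n)) * norm A"
  unfolding matrix_opnorm_def
proof (rule onorm_bound)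
  fix v :: "complex^'n"
  have entry: "cmod (A $ i $ j) \<le> norm A" for i j
    by (meson Finite_Cartesian_Product.norm_nth_le order_trans)
  have "norm (A *v v) \<le> (\<Sum>i\<in>UNIV. cmod (\<Sum>j\<in>UNIV. A $ i $ j * v $ j))"
    using norm_vec_le_sum[of "A *v v"] by (simp add: matrix_vector_mult_def)
  also have "\<dots> \<le> (\<Sum>(i::'n)\<in>UNIV. \<Sum>(j::'n)\<in>UNIV. norm A * norm v)"
    by (intro sum_mono order_trans[OF norm_sum])
       (auto simp: norm_mult intro!: mult_mono entry Finite_Cartesian_Product.norm_nth_le)
  finally show "norm (A *v v) \<le> of_nat (CARD('n) * CARD('n)) * norm A * norm v"
    by simp
qed simp

lemma tendsto_matrix_opnorm_iff:
  fixes X :: "nat \<Rightarrow> complex^'n^'n"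
  shows "(\<lambda>k. matrix_opnorm (X k - A)) \<longlonglongrightarrow> 0 \<longleftrightarrow> X \<longlonglongrightarrow> A"
proof
  assume *: "(\<lambda>k. matrix_opnorm (X k - A)) \<longlonglongrightarrow> 0"
  have "(\<lambda>k. X k $ i $ j - A $ i $ j) \<longlonglongrightarrow> 0" for i j
    using matrix_opnorm_component[of "X _ - A" i j]
    by (intro Lim_null_comparison[OF _ *]) simp
  then show "X \<longlonglongrightarrow> A"
    by (intro vec_tendstoI) (simp add: LIM_zero_iff)
next
  assume "X \<longlonglongrightarrow> A"
  then have lim: "(\<lambda>k. of_nat (CARD('n) * CARD('n)) * norm (X k - A)) \<longlonglongrightarrow> 0"
    by (intro tendsto_mult_right_zero tendsto_norm_zero LIM_zero)
  have nonneg: "0 \<le> matrix_opnorm (X k - A)" for k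
    unfolding matrix_opnorm_def by (rule onorm_pos_le[OF bounded_linear_matrix_vector_complex])
  show "(\<lambda>k. matrix_opnorm (X k - A)) \<longlonglongrightarrow> 0"
  proof (rule tendsto_sandwich[OF _ _ tendsto_const lim])
    show "\<forall>\<^sub>F k in sequentially. 0 \<le> matrix_opnorm (X k - A)"
      by (rule always_eventually) (rule allI, rule nonneg)
    show "\<forall>\<^sub>F k in sequentially.
        matrix_opnorm (X k - A) \<le> of_nat (CARD('n) * CARD('n)) * norm (X k - A)"
      by (rule always_eventually) (rule allI, rule matrix_opnorm_le_norm)
  qed
qed

end

theory Submission
  imports Defs
begin

text \<open>
  The states of the algebra of all \<open>2 \<times> 2\<close> matrices form a Euclidean ball, the Bloch ball, whose
  boundary sphere consists of the vector states.  Two facts about this ball give the theorem,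
  without any case distinction on the dimension of \<open>M\<close>.

  First, every state on every unital subspace is the restriction of a point of the ball
  (\<open>state_is_bloch_functional\<close>).  This is the Hahn--Banach theorem together with the fact that a
  contractive unital functional takes its value at \<open>x\<close> in the closed convex hull of the numerical
  range of \<open>x\<close> (\<open>Re_state_le_numerical_bound\<close>): a state outside the compact convex set of
  restrictions would be separated from it by some \<open>x\<close> in \<open>M\<close>, and would violate that bound.
  Applied to \<open>M\<close>, it yields existence of the extension.

  Second, the ball is strictly convex.  If a pure state \<open>\<phi>\<close> on \<open>M\<close> had two distinct extensions to
  \<open>C\<^sup>*(M)\<close>, these would come from two distinct points of the ball, and \<open>\<phi>\<close> would be the restriction
  of their midpoint, which is an interior point.  Moving this point a little in a direction \<open>e\<close> and
  in the direction \<open>-e\<close> writes \<open>\<phi>\<close> as a midpoint of two states on \<open>M\<close>; by purity the two coincide,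
  so no direction is seen by \<open>M\<close>.  This forces \<open>M\<close> to consist of scalar matrices
  (\<open>pure_state_at_interior_point\<close>).  But then \<open>C\<^sup>*(M)\<close> also consists of scalars and carries only one
  state.
\<close>

section \<open>Functionals dominated by a compact convex family\<close>

text \<open>
  A finite-dimensional Hahn--Banach theorem, in the form of a bipolar theorem.  With an orthonormal
  basis \<open>B\<close> of \<open>S\<close>, each functional \<open>h\<close> on \<open>S\<close> is the inner product with the vector
  \<open>\<Sum>b\<in>B. h b *\<^sub>R b\<close> of \<open>S\<close>.  The vectors that represent the family form a compact convex set.  If
  the vector of \<open>f\<close> were outside, the normal of the separating hyperplane at the nearest point,
  being a difference of two vectors of \<open>S\<close>, would be an element of \<open>S\<close> at which the domination
  fails.
\<close>

lemma dominated_functional_in_family: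
  fixes S :: "'a::euclidean_space set" and K :: "'b::real_normed_vector set"
    and F :: "'b \<Rightarrow> 'a \<Rightarrow> real"
  assumes S: "subspace S"
    and f_add: "\<And>x y. x \<in> S \<Longrightarrow> y \<in> S \<Longrightarrow> f (x + y) = f x + f y"
    and f_scale: "\<And>c x. x \<in> S \<Longrightarrow> f (c *\<^sub>R x) = c * f x"
    and K: "compact K" "convex K" "K \<noteq> {}"
    and F_lin: "\<And>k. linear (F k)"
    and F_cont: "\<And>x. continuous_on K (\<lambda>k. F k x)"
    and F_affine: "\<And>k l t x. F ((1 - t) *\<^sub>R k + t *\<^sub>R l) x = (1 - t) * F k x + t * F l x"
    and dom: "\<And>x c. x \<in> S \<Longrightarrow> (\<And>k. k \<in> K \<Longrightarrow> F k x \<le> c) \<Longrightarrow> f x \<le> c"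
  shows "\<exists>k\<in>K. \<forall>x\<in>S. f x = F k x"
proof -
  obtain B where B: "B \<subseteq> S" "pairwise orthogonal B" "\<And>b. b \<in> B \<Longrightarrow> norm b = 1"
      "independent B" "span B = S"
    using orthonormal_basis_subspace[OF S] by metis
  have finB: "finite B"
    using B(4) by (simp add: independent_imp_finite)
  define R where "R h = (\<Sum>b\<in>B. h b *\<^sub>R b)" for h :: "'a \<Rightarrow> real"
  have R_in: "R h \<in> S" for h
    unfolding R_def using B(1) S by (auto intro!: subspace_sum subspace_scale)
  have B_inner: "b \<bullet> b' = (if b = b' then 1 else 0)" if "b \<in> B" "b' \<in> B" for b b'
    using B(2,3) that by (auto simp: pairwise_def orthogonal_def dot_square_norm)
  have R_inner: "R h \<bullet> x = h x"
    if add: "\<And>x y. x \<in> S \<Longrightarrow> y \<in> S \<Longrightarrow> h (x + y) = h x + h y"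
      and scale: "\<And>c x. x \<in> S \<Longrightarrow> h (c *\<^sub>R x) = c * h x" and x: "x \<in> S"
    for h x
  proof -
    have "x \<in> span B"
      using x B(5) by simp
    then have "x \<in> S \<and> R h \<bullet> x = h x"
    proof (induction rule: span_induct_alt)
      case base
      show ?case
        using scale[of 0 0] S by (simp add: subspace_0)
    next
      case (step c b y)
      have "R h \<bullet> b = h b"
        using step(1) finB
        by (simp add: R_def inner_sum_left B_inner if_distrib cong: if_cong)
      moreover have "b \<in> S"
        using step(1) B(1) by auto
      ultimately show ?case
        using step(2) S by (simp add: inner_add_right add scale subspace_add subspace_scale)
    qed
    then show ?thesis ..
  qed
  define C where "C = (\<lambda>k. R (F k)) ` K"
  have "compact C"
    unfolding C_def R_def
    by (intro compact_continuous_image continuous_intros F_cont K)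
  have "convex C"
    unfolding convex_alt
  proof (intro ballI allI impI)
    fix u v and t :: real
    assume "u \<in> C" "v \<in> C" and t: "0 \<le> t \<and> t \<le> 1"
    then obtain k l where kl: "k \<in> K" "l \<in> K" "u = R (F k)" "v = R (F l)"
      by (auto simp: C_def)
    have "(1 - t) *\<^sub>R u + t *\<^sub>R v = R (F ((1 - t) *\<^sub>R k + t *\<^sub>R l))"
      by (simp add: kl R_def F_affine scaleR_sum_right sum.distrib scaleR_add_left)
    moreover have "(1 - t) *\<^sub>R k + t *\<^sub>R l \<in> K"
      using K(2) kl t by (simp add: convex_alt)
    ultimately show "(1 - t) *\<^sub>R u + t *\<^sub>R v \<in> C"
      by (simp add: C_def)
  qed
  have F_inner: "R (F k) \<bullet> x = F k x" if "x \<in> S" for k x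
    using R_inner[of "F k" x] that F_lin[of k] by (simp add: linear_add linear_scale)
  have f_inner: "R f \<bullet> x = f x" if "x \<in> S" for x
    using R_inner[of f x] that f_add f_scale by blast
  have "R f \<in> C"
  proof (rule ccontr)
    assume "R f \<notin> C"
    then obtain a b where a: "a \<in> C" and below: "(a - R f) \<bullet> R f < b"
      and above: "\<And>u. u \<in> C \<Longrightarrow> b < (a - R f) \<bullet> u"
      using separating_hyperplane_closed_point_inset[of C "R f"] \<open>compact C\<close> \<open>convex C\<close> K(3)
      by (auto simp: C_def compact_imp_closed)
    define x where "x = R f - a"
    have x: "x \<in> S"
      using a S by (auto simp: x_def C_def R_in subspace_diff)
    have "F k x \<le> -b" if "k \<in> K" for k
    proof -
      have "b < (a - R f) \<bullet> R (F k)"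
        using above that by (simp add: C_def)
      then show ?thesis
        using F_inner[OF x, of k] by (simp add: x_def inner_diff inner_commute)
    qed
    then have "f x \<le> -b"
      by (rule dom[OF x])
    then show False
      using below f_inner[OF x] by (simp add: x_def inner_diff inner_commute)
  qed
  then obtain k where "k \<in> K" "R f = R (F k)"
    by (auto simp: C_def)
  then show ?thesis
    using F_inner f_inner by metis
qed

section \<open>States and the numerical range\<close>

lemma statesD:
  assumes "\<phi> \<in> states M"
  shows "x \<in> M \<Longrightarrow> y \<in> M \<Longrightarrow> \<phi> (x + y) = \<phi> x + \<phi> y"
    and "x \<in> M \<Longrightarrow> \<phi> (matrix_scale c x) = c * \<phi> x"
    and "x \<in> M \<Longrightarrow> cmod (\<phi> x) \<le> matrix_opnorm x"
    and "\<phi> (mat 1) = 1"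
    and "\<phi> \<in> extensional M"
  using assms by (auto simp: states_def)

lemma scaleR_eq_matrix_scale: "t *\<^sub>R (x :: complex^'n^'n) = matrix_scale (of_real t) x"
  unfolding vec_eq_iff by (simp add: matrix_scale_def) (simp add: scaleR_conv_of_real)

lemma norm_matrix_vector_le_opnorm:
  "norm ((x :: complex^'n^'n) *v v) \<le> matrix_opnorm x * norm v"
  unfolding matrix_opnorm_def by (rule onorm[OF bounded_linear_matrix_vector_complex])

text \<open>
  If the numerical range of \<open>x\<close> lies in the half-plane \<open>Re z \<le> c\<close>, then
  \<open>\<parallel>I + t x\<parallel>\<^sup>2 \<le> 1 + 2 t c + O(t\<^sup>2)\<close> for \<open>t > 0\<close>, whereas contractivity bounds \<open>\<parallel>I + t x\<parallel>\<close> below by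
  \<open>\<bar>1 + t \<phi>(x)\<bar>\<close>; the claim is the comparison of the terms of first order.  The real inner product
  \<open>(x *v v) \<bullet> v\<close> is the real part of the complex one.
\<close>

lemma Re_state_le_numerical_bound:
  fixes M :: "(complex^'n^'n) set"
  assumes M: "unital_subspace M" and \<phi>: "\<phi> \<in> states M" and x: "x \<in> M"
    and bound: "\<And>v. norm v = 1 \<Longrightarrow> (x *v v) \<bullet> v \<le> c"
  shows "Re (\<phi> x) \<le> c"
proof -
  define N where "N = matrix_opnorm x"
  have form_le: "(x *v v) \<bullet> v \<le> c * (norm v)\<^sup>2" for v
  proof (cases "v = 0")
    case False
    define u where "u = (1 / norm v) *\<^sub>R v"
    have "norm u = 1" "v = norm v *\<^sub>R u"
      using False by (simp_all add: u_def)
    then have "(x *v v) \<bullet> v = (norm v)\<^sup>2 * ((x *v u) \<bullet> u)"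
      using linear_scale[OF bounded_linear.linear[OF bounded_linear_matrix_vector_complex[of x]],
          of "norm v" u]
      by (metis inner_scaleR_left inner_scaleR_right mult.assoc power2_eq_square)
    then show ?thesis
      using mult_left_mono[OF bound[OF \<open>norm u = 1\<close>], of "(norm v)\<^sup>2"] by (simp add: mult.commute)
  qed simp
  have first_order: "2 * (Re (\<phi> x) - c) \<le> t * N\<^sup>2" if t: "t > 0" for t :: real
  proof -
    define y where "y = mat 1 + t *\<^sub>R x"
    have yv: "y *v v = v + t *\<^sub>R (x *v v)" for v
      by (simp add: y_def matrix_vector_mult_add_rdistrib)
        (simp add: vec_eq_iff matrix_vector_mult_def scaleR_sum_right)
    define q where "q = 1 + 2 * t * c + t\<^sup>2 * N\<^sup>2"
    have norm_yv: "(norm (y *v v))\<^sup>2 \<le> q * (norm v)\<^sup>2" for v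
    proof -
      have "(norm (y *v v))\<^sup>2 = (norm v)\<^sup>2 + 2 * t * ((x *v v) \<bullet> v) + t\<^sup>2 * (norm (x *v v))\<^sup>2"
        unfolding yv power2_norm_eq_inner
        by (simp add: inner_add_left inner_add_right inner_commute power2_eq_square algebra_simps)
      also have "\<dots> \<le> (norm v)\<^sup>2 + 2 * t * (c * (norm v)\<^sup>2) + t\<^sup>2 * (N * norm v)\<^sup>2"
        using form_le[of v] norm_matrix_vector_le_opnorm[of x v] t
        by (intro add_mono mult_left_mono power_mono) (auto simp: N_def)
      finally show ?thesis
        by (simp add: q_def algebra_simps power_mult_distrib)
    qed
    have "q \<ge> 0"
    proof -
      have "0 \<le> q * (norm (axis undefined 1 :: complex^'n))\<^sup>2"
        using norm_yv zero_le_power2 order_trans by blast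
      then show ?thesis
        by (simp add: norm_axis_1)
    qed
    have "matrix_opnorm y \<le> sqrt q"
      unfolding matrix_opnorm_def
    proof (rule onorm_bound)
      show "norm (y *v v) \<le> sqrt q * norm v" for v
        using real_sqrt_le_mono[OF norm_yv[of v]] by (simp add: real_sqrt_mult)
    qed (simp add: \<open>q \<ge> 0\<close>)
    moreover have "y \<in> M" "\<phi> y = 1 + of_real t * \<phi> x"
      using M x statesD[OF \<phi>] unfolding y_def scaleR_eq_matrix_scale unital_subspace_def
      by (auto intro: matrix_space.subspace_add matrix_space.subspace_scale
          simp: matrix_space.subspace_scale)
    ultimately have "cmod (1 + of_real t * \<phi> x) \<le> sqrt q"
      using statesD(3)[OF \<phi>, of y] by simp
    then have "(cmod (1 + of_real t * \<phi> x))\<^sup>2 \<le> q"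
      by (metis \<open>q \<ge> 0\<close> norm_ge_zero power_mono real_sqrt_pow2)
    moreover have "(1 + t * Re (\<phi> x))\<^sup>2 \<le> (cmod (1 + of_real t * \<phi> x))\<^sup>2"
      by (simp add: cmod_power2)
    ultimately have "(1 + t * Re (\<phi> x))\<^sup>2 \<le> q"
      by linarith
    then have "t * (2 * (Re (\<phi> x) - c)) + (t * Re (\<phi> x))\<^sup>2 \<le> t * (t * N\<^sup>2)"
      by (simp add: q_def power2_eq_square algebra_simps)
    then have "t * (2 * (Re (\<phi> x) - c)) \<le> t * (t * N\<^sup>2)"
      using zero_le_power2[of "t * Re (\<phi> x)"] by linarith
    then show ?thesis
      using t by simp
  qed
  have "((\<lambda>t. t * N\<^sup>2) \<longlongrightarrow> 0 * N\<^sup>2) (at_right 0)"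
    by (intro tendsto_intros)
  moreover have "\<forall>\<^sub>F t in at_right 0. 2 * (Re (\<phi> x) - c) \<le> t * N\<^sup>2"
    using first_order by (auto simp: eventually_at_right_field intro: exI[of _ 1])
  ultimately have "2 * (Re (\<phi> x) - c) \<le> 0 * N\<^sup>2"
    by (intro tendsto_lowerbound) auto
  then show ?thesis
    by simp
qed

section \<open>The Bloch ball\<close>

text \<open>
  With \<open>r = (z, s)\<close>, this is \<open>x \<mapsto> trace (D ** x)\<close> for the matrix \<open>D\<close> of trace one with diagonal
  \<open>(1 + s) / 2\<close>, \<open>(1 - s) / 2\<close> and off-diagonal entries \<open>z / 2\<close>, \<open>cnj z / 2\<close>.  The eigenvalues of \<open>D\<close>
  are \<open>(1 \<plusminus> norm r) / 2\<close>, so that \<open>D\<close> is a density matrix exactly if \<open>norm r \<le> 1\<close>, and a projection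
  of rank one exactly if \<open>norm r = 1\<close>.  The type \<open>complex \<times> real\<close> carries the Euclidean norm
  of three-dimensional space.
\<close>

definition bloch_functional :: "complex \<times> real \<Rightarrow> complex^2^2 \<Rightarrow> complex" where
  "bloch_functional r x =
     (x $ 1 $ 1 + x $ 2 $ 2 + of_real (snd r) * (x $ 1 $ 1 - x $ 2 $ 2)
      + cnj (fst r) * x $ 1 $ 2 + fst r * x $ 2 $ 1) / 2"

definition vector_functional :: "complex^'n \<Rightarrow> complex^'n^'n \<Rightarrow> complex" where
  "vector_functional v x = (\<Sum>i\<in>UNIV. cnj (v $ i) * (x *v v) $ i)"

lemma Re_vector_functional: "Re (vector_functional v x) = (x *v v) \<bullet> v"
  by (simp add: vector_functional_def inner_vec_def inner_complex_def algebra_simps)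

lemma cmod_vector_functional_le:
  assumes "norm v = 1"
  shows "cmod (vector_functional v x) \<le> matrix_opnorm x"
proof -
  have "cmod (vector_functional v x) \<le> (\<Sum>i\<in>UNIV. \<bar>cmod (v $ i)\<bar> * \<bar>cmod ((x *v v) $ i)\<bar>)"
    unfolding vector_functional_def by (rule order_trans[OF norm_sum]) (simp add: norm_mult)
  also have "\<dots> \<le> norm v * norm (x *v v)"
    unfolding norm_vec_def by (rule L2_set_mult_ineq)
  also have "\<dots> \<le> matrix_opnorm x"
    using norm_matrix_vector_le_opnorm[of x v] assms by simp
  finally show ?thesis .
qed

lemma norm_vec2_squared: "(norm (v :: complex^2))\<^sup>2 = (cmod (v $ 1))\<^sup>2 + (cmod (v $ 2))\<^sup>2"
  by (simp add: norm_vec_def L2_set_def sum_2)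

lemma norm_pair_squared: "(norm (z :: complex, s :: real))\<^sup>2 = (cmod z)\<^sup>2 + s\<^sup>2"
  by (simp add: norm_Pair)

text \<open>
  The point with coordinates \<open>z = 2 v\<^sub>1 cnj v\<^sub>2\<close> and \<open>s = \<bar>v\<^sub>1\<bar>\<^sup>2 - \<bar>v\<^sub>2\<bar>\<^sup>2\<close> is the image of \<open>v\<close> under
  the Hopf map from the unit sphere of \<open>complex^2\<close> to the sphere in three dimensions.
\<close>

lemma vector_functional_is_bloch_functional:
  fixes v :: "complex^2"
  assumes "norm v = 1"
  shows "\<exists>r. norm r = 1 \<and> vector_functional v = bloch_functional r"
proof -
  let ?a = "v $ 1" and ?b = "v $ 2"
  define r where "r = (2 * ?a * cnj ?b, (cmod ?a)\<^sup>2 - (cmod ?b)\<^sup>2)"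
  have sum1: "(cmod ?a)\<^sup>2 + (cmod ?b)\<^sup>2 = 1"
    using norm_vec2_squared[of v] assms by simp
  have "(norm r)\<^sup>2 = ((cmod ?a)\<^sup>2 + (cmod ?b)\<^sup>2)\<^sup>2"
    unfolding r_def norm_pair_squared
    by (simp add: norm_mult power2_eq_square algebra_simps)
  then have "norm r = 1"
    by (simp add: sum1 power2_eq_1_iff) (use norm_ge_zero[of r] in linarith)
  moreover have "vector_functional v x = bloch_functional r x" for x
  proof -
    have aa: "cnj ?a * ?a = of_real ((1 + snd r) / 2)"
      and bb: "cnj ?b * ?b = of_real ((1 - snd r) / 2)"
    proof -
      have "(cmod ?a)\<^sup>2 = (1 + snd r) / 2" "(cmod ?b)\<^sup>2 = (1 - snd r) / 2"
        using sum1 by (simp_all add: r_def)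
      then show "cnj ?a * ?a = of_real ((1 + snd r) / 2)" "cnj ?b * ?b = of_real ((1 - snd r) / 2)"
        by (metis complex_norm_square mult.commute)+
    qed
    have "vector_functional v x
        = (cnj ?a * ?a) * x $ 1 $ 1 + (cnj ?b * ?b) * x $ 2 $ 2
          + cnj ?a * ?b * x $ 1 $ 2 + ?a * cnj ?b * x $ 2 $ 1"
      by (simp add: vector_functional_def matrix_vector_mult_def sum_2 algebra_simps)
    also have "\<dots> = bloch_functional r x"
      unfolding aa bb by (simp add: bloch_functional_def r_def field_simps)
    finally show ?thesis .
  qed
  ultimately show ?thesis
    by blast
qed

text \<open>
  Surjectivity of the Hopf map: the phase of \<open>v\<close> being free, its first coordinate can be taken to
  be real, and the second one is then determined, except at the pole \<open>s = -1\<close>.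
\<close>

lemma bloch_functional_is_vector_functional:
  assumes "norm r = 1"
  shows "\<exists>v. norm v = 1 \<and> bloch_functional r = vector_functional v"
proof -
  obtain z s where r: "r = (z, s)"
    by (cases r)
  have zs: "(cmod z)\<^sup>2 + s\<^sup>2 = 1"
    using norm_pair_squared[of z s] assms r by simp
  show ?thesis
  proof (cases "s = -1")
    case True
    then have "z = 0"
      using zs by simp
    define v :: "complex^2" where "v = axis 2 1"
    have "bloch_functional r x = vector_functional v x" for x
      by (simp add: r True \<open>z = 0\<close> v_def bloch_functional_def vector_functional_def
          matrix_vector_mult_def sum_2 axis_def)
    moreover have "norm v = 1"
      by (simp add: v_def norm_axis_1)
    ultimately show ?thesis
      by blast
  next
    case False
    have "s\<^sup>2 \<le> 1"
      using zs zero_le_power2[of "cmod z"] by linarith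
    then have s: "-1 < s"
      using False abs_square_le_1[of s] by linarith
    define a where "a = sqrt ((1 + s) / 2)"
    have a: "a > 0" "a\<^sup>2 = (1 + s) / 2"
      using s by (simp_all add: a_def)
    define b where "b = cnj z / of_real (2 * a)"
    define v :: "complex^2" where "v = (\<chi> i. if i = 1 then of_real a else b)"
    have v: "v $ 1 = of_real a" "v $ 2 = b"
      by (simp_all add: v_def)
    have ab: "of_real a * cnj b = z / 2" "of_real a * b = cnj z / 2"
      using a(1) by (simp_all add: b_def)
    have b2: "(cmod b)\<^sup>2 = (1 - s) / 2"
    proof -
      have "(cmod b)\<^sup>2 = (cmod z)\<^sup>2 / (4 * a\<^sup>2)"
        using a(1) by (simp add: b_def norm_divide norm_mult power_divide power_mult_distrib)
      also have "\<dots> = ((1 - s) * (1 + s)) / (2 * (1 + s))"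
      proof -
        have "(cmod z)\<^sup>2 = (1 - s) * (1 + s)"
          using zs by (simp add: power2_eq_square algebra_simps)
        moreover have "4 * a\<^sup>2 = 2 * (1 + s)"
          by (simp add: a(2))
        ultimately show ?thesis
          by simp
      qed
      also have "\<dots> = (1 - s) / 2"
        using s by (intro mult_divide_mult_cancel_right) simp
      finally show ?thesis .
    qed
    have "(norm v)\<^sup>2 = 1"
      unfolding norm_vec2_squared v using a b2 by (simp add: field_simps)
    then have nv: "norm v = 1"
      by (simp add: power2_eq_1_iff) (use norm_ge_zero[of v] in linarith)
    have bb: "cnj b * b = of_real ((1 - s) / 2)"
      using b2 by (metis complex_norm_square mult.commute)
    have aa: "of_real a * of_real a = complex_of_real ((1 + s) / 2)"
      using a(2) by (metis of_real_mult power2_eq_square)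
    have "bloch_functional r x = vector_functional v x" for x
    proof -
      have "vector_functional v x
          = (of_real a * of_real a) * x $ 1 $ 1 + (cnj b * b) * x $ 2 $ 2
            + (of_real a * b) * x $ 1 $ 2 + (of_real a * cnj b) * x $ 2 $ 1"
        by (simp add: vector_functional_def matrix_vector_mult_def sum_2 v algebra_simps)
      also have "\<dots> = bloch_functional r x"
        unfolding aa bb ab by (simp add: bloch_functional_def r field_simps)
      finally show ?thesis
        by simp
    qed
    then show ?thesis
      using nv by blast
  qed
qed

lemma bloch_functional_affine:
  "bloch_functional ((1 - t) *\<^sub>R k + t *\<^sub>R l) x
     = of_real (1 - t) * bloch_functional k x + of_real t * bloch_functional l x"
  by (simp add: bloch_functional_def scaleR_conv_of_real field_simps)

lemma bloch_functional_add: "bloch_functional r (x + y) = bloch_functional r x + bloch_functional r y"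
  by (simp add: bloch_functional_def field_simps)

lemma bloch_functional_scale: "bloch_functional r (matrix_scale c x) = c * bloch_functional r x"
  by (simp add: bloch_functional_def matrix_scale_def field_simps)

lemma bloch_functional_one: "bloch_functional r (mat 1) = 1"
  by (simp add: bloch_functional_def mat_def)

text \<open>
  A point of the ball lies on the diameter through it, hence is a convex combination of two
  antipodal points of the sphere, which are vector states.
\<close>

lemma cmod_bloch_functional_le:
  assumes "norm r \<le> 1"
  shows "cmod (bloch_functional r x) \<le> matrix_opnorm x"
proof -
  have sphere: "cmod (bloch_functional u x) \<le> matrix_opnorm x" if "norm u = 1" for u
    using bloch_functional_is_vector_functional[OF that] cmod_vector_functional_le by metis
  obtain u where u: "norm u = 1" "r = norm r *\<^sub>R u"
  proof (cases "r = 0")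
    case True
    then show ?thesis
      using that[of "(0, 1)"] by (simp add: norm_Pair zero_prod_def)
  next
    case False
    then show ?thesis
      using that[of "(1 / norm r) *\<^sub>R r"] by simp
  qed
  define t where "t = (1 - norm r) / 2"
  have t: "0 \<le> t" "t \<le> 1"
    using assms by (auto simp: t_def) (use norm_ge_zero[of r] in linarith)
  have "(1 - t) *\<^sub>R u + t *\<^sub>R (-u) = (1 - 2 * t) *\<^sub>R u"
    by (simp add: algebra_simps scaleR_2 flip: scaleR_scaleR)
  also have "\<dots> = r"
    proof -
      have "1 - 2 * t = norm r"
        by (simp add: t_def field_simps)
      then show ?thesis
        using u(2) by metis
    qed
  finally have "bloch_functional r x
      = of_real (1 - t) * bloch_functional u x + of_real t * bloch_functional (-u) x"
    using bloch_functional_affine[of t u "-u" x] by simp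
  then have "cmod (bloch_functional r x)
      \<le> cmod (of_real (1 - t) * bloch_functional u x) + cmod (of_real t * bloch_functional (-u) x)"
    by (simp only: norm_triangle_ineq)
  also have "\<dots> = (1 - t) * cmod (bloch_functional u x) + t * cmod (bloch_functional (-u) x)"
    using t by (simp add: norm_mult del: of_real_diff)
  also have "\<dots> \<le> (1 - t) * matrix_opnorm x + t * matrix_opnorm x"
    using t sphere[of u] sphere[of "-u"] u(1) by (intro add_mono mult_left_mono) auto
  finally show ?thesis
    by (simp add: algebra_simps)
qed

lemma restrict_bloch_functional_in_states:
  assumes M: "unital_subspace M" and r: "norm r \<le> 1"
  shows "restrict (bloch_functional r) M \<in> states M"
  using M cmod_bloch_functional_le[OF r]
  by (auto simp: states_def unital_subspace_def bloch_functional_add bloch_functional_scale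
      bloch_functional_one matrix_space.subspace_add matrix_space.subspace_scale)

text \<open>
  Every state on a unital subspace comes from the ball.  The real parts of the functionals of the
  ball form a compact convex family, which dominates the real part of a state because it contains
  the numerical range; and the real part determines a complex-linear functional.
\<close>

lemma state_is_bloch_functional:
  assumes M: "unital_subspace M" and \<phi>: "\<phi> \<in> states M"
  shows "\<exists>r. norm r \<le> 1 \<and> (\<forall>x\<in>M. \<phi> x = bloch_functional r x)"
proof -
  have sub: "matrix_space.subspace M"
    using M by (simp add: unital_subspace_def)
  have "\<exists>r\<in>cball 0 1. \<forall>x\<in>M. Re (\<phi> x) = Re (bloch_functional r x)"
  proof (rule dominated_functional_in_family)
    show "subspace M"
      using sub unfolding subspace_def scaleR_eq_matrix_scale matrix_space.subspace_def by blast
    show "linear (\<lambda>x. Re (bloch_functional k x))" for k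
      by (rule linearI)
        (simp_all add: bloch_functional_add scaleR_eq_matrix_scale bloch_functional_scale)
    show "continuous_on (cball 0 1) (\<lambda>k. Re (bloch_functional k x))" for x
      unfolding bloch_functional_def by (intro continuous_intros) auto
    show "Re (\<phi> x) \<le> c"
      if "x \<in> M" and c: "\<And>k. k \<in> cball 0 1 \<Longrightarrow> Re (bloch_functional k x) \<le> c" for x c
    proof (rule Re_state_le_numerical_bound[OF M \<phi> \<open>x \<in> M\<close>])
      fix v :: "complex^2"
      assume "norm v = 1"
      then obtain k where "norm k = 1" "vector_functional v = bloch_functional k"
        using vector_functional_is_bloch_functional by blast
      then show "(x *v v) \<bullet> v \<le> c"
        using c[of k] by (simp flip: Re_vector_functional)
    qed
  qed (use statesD[OF \<phi>] in \<open>simp_all add: scaleR_eq_matrix_scale bloch_functional_affine\<close>)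
  then obtain r where r: "norm r \<le> 1" "\<And>x. x \<in> M \<Longrightarrow> Re (\<phi> x) = Re (bloch_functional r x)"
    by auto
  have "\<phi> x = bloch_functional r x" if x: "x \<in> M" for x
  proof (rule complex_eqI)
    show "Re (\<phi> x) = Re (bloch_functional r x)"
      by (rule r(2)[OF x])
    show "Im (\<phi> x) = Im (bloch_functional r x)"
      using r(2)[OF matrix_space.subspace_scale[OF sub x, of \<i>]] statesD(2)[OF \<phi> x, of \<i>]
      by (simp add: bloch_functional_scale)
  qed
  then show ?thesis
    using r(1) by blast
qed

section \<open>Pure states on a unital subspace\<close>

text \<open>
  The functional of an interior point \<open>m\<close> is the midpoint of those of \<open>m + d *\<^sub>R e\<close> and
  \<open>m - d *\<^sub>R e\<close>, where \<open>d\<close> is the distance from \<open>m\<close> to the sphere.  If its restriction is pure, the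
  two restrictions agree; for the three coordinate directions \<open>e\<close> this says that the components of
  \<open>x\<close> along the three Pauli matrices vanish.
\<close>

lemma pure_state_at_interior_point:
  assumes M: "unital_subspace M" and pure: "pure_state M \<phi>"
    and m: "norm m < 1" "\<And>x. x \<in> M \<Longrightarrow> \<phi> x = bloch_functional m x"
  shows "M \<subseteq> range (\<lambda>c. matrix_scale c (mat 1))"
proof
  fix x assume x: "x \<in> M"
  define d where "d = 1 - norm m"
  have d: "d > 0"
    using m(1) by (simp add: d_def)
  have direction: "of_real (snd e) * (x $ 1 $ 1 - x $ 2 $ 2)
      + cnj (fst e) * x $ 1 $ 2 + fst e * x $ 2 $ 1 = 0" (is "?c = 0")
    if e: "norm e = 1" for e
  proof -
    let ?p = "restrict (bloch_functional (m + d *\<^sub>R e)) M"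
    let ?q = "restrict (bloch_functional (m - d *\<^sub>R e)) M"
    have "norm (m + d *\<^sub>R e) \<le> 1" "norm (m - d *\<^sub>R e) \<le> 1"
      using norm_triangle_ineq[of m "d *\<^sub>R e"] norm_triangle_ineq4[of m "d *\<^sub>R e"] e d
      by (simp_all add: d_def)
    then have states: "?p \<in> states M" "?q \<in> states M"
      using restrict_bloch_functional_in_states[OF M] by blast+
    have "m = (1 - 1/2) *\<^sub>R (m + d *\<^sub>R e) + (1/2) *\<^sub>R (m - d *\<^sub>R e)"
      by (simp add: algebra_simps flip: scaleR_add_left)
    then have mid: "bloch_functional m y = of_real (1 - 1/2) * bloch_functional (m + d *\<^sub>R e) y
        + of_real (1/2) * bloch_functional (m - d *\<^sub>R e) y" for y
      using bloch_functional_affine[of "1/2" "m + d *\<^sub>R e" "m - d *\<^sub>R e" y] by metis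
    have "\<forall>y\<in>M. \<phi> y = of_real (1 - 1/2) * ?p y + of_real (1/2) * ?q y"
      using m(2) mid by simp
    moreover have "0 < (1/2 :: real)" "(1/2 :: real) < 1"
      by simp_all
    ultimately have "?p = ?q"
      using pure states unfolding pure_state_def by blast
    then have "bloch_functional (m + d *\<^sub>R e) x = bloch_functional (m - d *\<^sub>R e) x"
      using x by (metis restrict_apply')
    moreover have "bloch_functional (m + d *\<^sub>R e) x - bloch_functional (m - d *\<^sub>R e) x = of_real d * ?c"
      by (simp add: bloch_functional_def scaleR_conv_of_real field_simps)
    ultimately show ?thesis
      using d by simp
  qed
  have "x $ 1 $ 1 = x $ 2 $ 2"
    using direction[of "(0, 1)"] by (simp add: norm_Pair)
  moreover have "x $ 1 $ 2 + x $ 2 $ 1 = 0"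
    using direction[of "(1, 0)"] by (simp add: norm_Pair)
  moreover have "x $ 2 $ 1 - x $ 1 $ 2 = 0"
  proof -
    have "\<i> * (x $ 2 $ 1 - x $ 1 $ 2) = 0"
      using direction[of "(\<i>, 0)"] by (simp add: norm_Pair algebra_simps)
    then show ?thesis
      by simp
  qed
  ultimately have "x = matrix_scale (x $ 1 $ 1) (mat 1)"
    by (simp add: vec_eq_iff forall_2 matrix_scale_def mat_def)
  then show "x \<in> range (\<lambda>c. matrix_scale c (mat 1))"
    by blast
qed

lemma cstar_subalgebra_scalars:
  "cstar_subalgebra (range (\<lambda>c. matrix_scale c (mat 1 :: complex^'n^'n)))"
proof -
  let ?S = "range (\<lambda>c. matrix_scale c (mat 1 :: complex^'n^'n))"
  have sub: "matrix_space.subspace ?S"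
    using matrix_space.span_singleton matrix_space.subspace_span by metis
  \<comment> \<open>equations between entries define a closed set; the fixed index \<open>undefined\<close> serves to read
    off the scalar\<close>
  have "x \<in> ?S \<longleftrightarrow> (\<forall>i j. x $ i $ j = mat 1 $ i $ j * x $ undefined $ undefined)"
    (is "_ \<longleftrightarrow> ?P x")
    for x :: "complex^'n^'n"
  proof
    assume P: "?P x"
    define c where "c = x $ undefined $ undefined"
    have "\<forall>i j. x $ i $ j = mat 1 $ i $ j * c"
      using P unfolding c_def .
    then have "x = matrix_scale c (mat 1)"
      by (simp add: vec_eq_iff matrix_scale_def mult.commute)
    then show "x \<in> ?S"
      by blast
  qed (auto simp: matrix_scale_def mat_def)
  then have "?S = {x. \<forall>i j. x $ i $ j = mat 1 $ i $ j * x $ undefined $ undefined}"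
    by blast
  moreover have "closed {x :: complex^'n^'n.
      \<forall>i j. x $ i $ j = mat 1 $ i $ j * x $ undefined $ undefined}"
    by (intro closed_Collect_all closed_Collect_eq continuous_intros)
  ultimately have "closed ?S"
    by simp
  moreover have "matrix_scale c (mat 1) ** matrix_scale d (mat 1)
      = matrix_scale (c * d) (mat 1 :: complex^'n^'n)" for c d
    by (simp add: vec_eq_iff matrix_scale_def mat_def matrix_matrix_mult_def if_distrib cong: if_cong)
      (auto intro!: sum.neutral)
  moreover have "matrix_star (matrix_scale c (mat 1)) = matrix_scale (cnj c) (mat 1 :: complex^'n^'n)"
    for c
    by (auto simp: vec_eq_iff matrix_scale_def mat_def matrix_star_def transpose_def)
  ultimately show ?thesis
    using sub unfolding cstar_subalgebra_def by blast
qed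

theorem theorem2p5:
  fixes M :: "(complex^2^2) set"
  assumes "unital_subspace M"
  shows "pure_extension_property M (cstar_generated M)"
  unfolding pure_extension_property_def
proof (intro allI impI)
  fix \<phi> assume pure: "pure_state M \<phi>"
  define B where "B = cstar_generated M"
  have MB: "M \<subseteq> B"
    unfolding B_def by (rule subset_cstar_generated)
  have B: "unital_subspace B"
    using assms MB cstar_subalgebra_cstar_generated[of M]
    by (auto simp: B_def unital_subspace_def cstar_subalgebra_def)
  have \<phi>: "\<phi> \<in> states M"
    using pure by (simp add: pure_state_def)
  show "\<exists>!\<psi>. \<psi> \<in> states (cstar_generated M) \<and> (\<forall>x\<in>M. \<psi> x = \<phi> x)"
    unfolding B_def[symmetric]
  proof (rule ex_ex1I)
    obtain r where "norm r \<le> 1" "\<forall>x\<in>M. \<phi> x = bloch_functional r x"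
      using state_is_bloch_functional[OF assms \<phi>] by blast
    then have "restrict (bloch_functional r) B \<in> states B
        \<and> (\<forall>x\<in>M. restrict (bloch_functional r) B x = \<phi> x)"
      using restrict_bloch_functional_in_states[OF B] MB by auto
    then show "\<exists>\<psi>. \<psi> \<in> states B \<and> (\<forall>x\<in>M. \<psi> x = \<phi> x)"
      by (intro exI[of _ "restrict (bloch_functional r) B"])
  next
    fix \<psi>\<^sub>1 \<psi>\<^sub>2
    assume "\<psi>\<^sub>1 \<in> states B \<and> (\<forall>x\<in>M. \<psi>\<^sub>1 x = \<phi> x)" and "\<psi>\<^sub>2 \<in> states B \<and> (\<forall>x\<in>M. \<psi>\<^sub>2 x = \<phi> x)"
    then have \<psi>: "\<psi>\<^sub>1 \<in> states B" "\<psi>\<^sub>2 \<in> states B"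
      and ext: "\<And>x. x \<in> M \<Longrightarrow> \<psi>\<^sub>1 x = \<phi> x" "\<And>x. x \<in> M \<Longrightarrow> \<psi>\<^sub>2 x = \<phi> x"
      by auto
    obtain r\<^sub>1 r\<^sub>2 where r: "norm r\<^sub>1 \<le> 1" "norm r\<^sub>2 \<le> 1"
        "\<And>x. x \<in> B \<Longrightarrow> \<psi>\<^sub>1 x = bloch_functional r\<^sub>1 x" "\<And>x. x \<in> B \<Longrightarrow> \<psi>\<^sub>2 x = bloch_functional r\<^sub>2 x"
      using state_is_bloch_functional[OF B \<psi>(1)] state_is_bloch_functional[OF B \<psi>(2)] by blast
    have "\<psi>\<^sub>1 x = \<psi>\<^sub>2 x" if x: "x \<in> B" for x
    proof (cases "r\<^sub>1 = r\<^sub>2")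
      case True
      then show ?thesis
        using r x by simp
    next
      case False
      define m where "m = (1 - 1/2) *\<^sub>R r\<^sub>1 + (1/2) *\<^sub>R r\<^sub>2"
      \<comment> \<open>strict convexity of the ball, from the parallelogram identity\<close>
      have "(norm m)\<^sup>2 = ((norm r\<^sub>1)\<^sup>2 + (norm r\<^sub>2)\<^sup>2) / 2 - (norm (r\<^sub>1 - r\<^sub>2))\<^sup>2 / 4"
        unfolding m_def power2_norm_eq_inner by (simp add: inner_add inner_diff inner_commute field_simps)
      also have "\<dots> < 1"
      proof -
        have "(p + q) / 2 - w / 4 < 1" if "p \<le> 1" "q \<le> 1" "w > 0" for p q w :: real
          using that by (simp add: field_simps)
        moreover have "(norm r\<^sub>1)\<^sup>2 \<le> 1" "(norm r\<^sub>2)\<^sup>2 \<le> 1"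
          using r(1,2) by (simp_all add: power_le_one)
        moreover have "(norm (r\<^sub>1 - r\<^sub>2))\<^sup>2 > 0"
          using False by simp
        ultimately show ?thesis
          by blast
      qed
      finally have "norm m < 1"
        by (simp add: power2_less_imp_less[of "norm m" 1])
      moreover have "\<phi> y = bloch_functional m y" if "y \<in> M" for y
      proof -
        have "bloch_functional r\<^sub>1 y = \<phi> y" "bloch_functional r\<^sub>2 y = \<phi> y"
          using ext[OF that] r(3,4)[of y] that MB by auto
        then show ?thesis
          unfolding m_def bloch_functional_affine by (simp flip: distrib_right)
      qed
      ultimately have "M \<subseteq> range (\<lambda>c. matrix_scale c (mat 1))"
        by (rule pure_state_at_interior_point[OF assms pure])
      then have "B \<subseteq> range (\<lambda>c. matrix_scale c (mat 1))"
        unfolding B_def cstar_generated_def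
        by (rule hull_minimal) (rule cstar_subalgebra_scalars)
      then obtain c where "x = matrix_scale c (mat 1)"
        using x by blast
      then show ?thesis
        using B \<psi>[THEN statesD(2)] \<psi>[THEN statesD(4)] by (simp add: unital_subspace_def)
    qed
    then show "\<psi>\<^sub>1 = \<psi>\<^sub>2"
      using \<psi>[THEN statesD(5)] by (intro extensionalityI[of _ B])
  qed
qed

end
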